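(* Let $r\ge 1$ and let $a_1,\ldots,a_r$ be positive integers. Put $m=\sum_{i=1}^{r}(a_i-1)+1$ and $p=\max\{a_1,\ldots,a_r\}$. If $m\geq p+2$ and $p\geq 3$, then $$F(a_1,\ldots,a_r;m-1)\leq m+3p.$$
   Context: All graphs are finite and simple (undirected, no loops, no multiple edges). A $k$-clique of a graph is a set of $k$ pairwise adjacent vertices, and $cl(G)$ is the largest $k$ such that $G$ contains a $k$-clique. For positive integers $a_1,\ldots,a_r$, write $G\rightarrow(a_1,\ldots,a_r)$ if for every partition $V(G)=V_1\cup\cdots\cup V_r$ into pairwise disjoint (possibly empty) sets there is some $i\in\{1,\ldots,r\}$ such that $V_i$ contains an $a_i$-clique of $G$. For a positive integer $q$, the vertex Folkman number is $$F(a_1,\ldots,a_r;q)=\min\{|V(G)| : G\rightarrow(a_1,\ldots,a_r)\text{ and } cl(G)<q\}.$$ (By a theorem of Folkman this minimum is over a nonempty set if and only if $q>\max\{a_1,\ldots,a_r\}$.) *)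

theory Defs
  imports "HOL-Library.Ramsey" "HOL-Library.Disjoint_Sets" "HOL-Library.Extended_Nat"
begin

text \<open>
  A graph is a vertex set \<open>V\<close> with a set \<open>E\<close> of two-element subsets of \<open>V\<close>; \<^const>\<open>clique\<close> is the
  library's predicate for sets of pairwise adjacent vertices.
\<close>

definition simple_graph :: "'v set \<Rightarrow> 'v set set \<Rightarrow> bool" where
  "simple_graph V E \<longleftrightarrow> finite V \<and> E \<subseteq> nsets V 2"

definition contains_clique :: "'v set \<Rightarrow> 'v set set \<Rightarrow> nat \<Rightarrow> bool" where
  "contains_clique W E k \<longleftrightarrow> (\<exists>K \<subseteq> W. finite K \<and> card K = k \<and> clique K E)"

definition clique_number :: "'v set \<Rightarrow> 'v set set \<Rightarrow> nat" where
  "clique_number V E = Max {k. contains_clique V E k}"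

definition arrows :: "'v set \<Rightarrow> 'v set set \<Rightarrow> nat \<Rightarrow> (nat \<Rightarrow> nat) \<Rightarrow> bool" where
  "arrows V E r a \<longleftrightarrow>
     (\<forall>P. disjoint_family_on P {1..r} \<and> (\<Union>i\<in>{1..r}. P i) = V \<longrightarrow>
        (\<exists>i\<in>{1..r}. contains_clique (P i) E (a i)))"

text \<open>
  Up to isomorphism every finite graph has its vertices in \<^typ>\<open>nat\<close>. The value lies in \<^typ>\<open>enat\<close>
  so that the infimum of the empty set is \<open>\<infinity>\<close>: an upper bound on the Folkman number thus
  includes the existence of a graph, which the infimum over \<^typ>\<open>nat\<close>, with value \<open>0\<close> on the empty
  set, would not. For a nonempty set the infimum is the minimum.
\<close>

definition vertex_Folkman :: "nat \<Rightarrow> (nat \<Rightarrow> nat) \<Rightarrow> nat \<Rightarrow> enat" where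
  "vertex_Folkman r a q =
     Inf {enat (card V) | (V :: nat set) E.
            simple_graph V E \<and> arrows V E r a \<and> clique_number V E < q}"

end

theory Submission
  imports Defs
begin

text \<open>
  The graph is described by its complement \<open>H\<close>. Put \<open>n = 2p + 1\<close>. The complement consists of
  an odd cycle \<open>x\<^sub>0, \<dots>, x\<^sub>n\<^sub>-\<^sub>1\<close>, of \<open>n\<close> mutually \<open>H\<close>-adjacent vertices \<open>y\<^sub>j\<close> (the apexes), each
  \<open>H\<close>-adjacent to \<open>x\<^sub>j\<close>, \<open>x\<^sub>j\<^sub>+\<^sub>1\<close> and \<open>x\<^sub>j\<^sub>+\<^sub>4\<close>, and of \<open>t = m - p - 2\<close> isolated vertices, which
  dominate the graph itself. In total these are \<open>4p + 2 + t = m + 3p\<close> vertices. Cliques of the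
  graph are the independent sets of \<open>H\<close>.

  The clique number is at most \<open>p + t = m - 2\<close>: an odd cycle of length \<open>2p + 1\<close> has independence
  number \<open>p\<close>, and this drops by one when the three neighbours of an apex are deleted, while the
  apexes contribute at most one vertex (\<open>clique_card_le\<close>).

  For the arrow property, let the vertices without the dominating ones be split into \<open>A\<close> and \<open>B\<close>.
  Each edge of the cycle between \<open>A\<close> and \<open>B\<close> is harmless for cliques inside a part. If two such
  edges are far enough apart, walking around the cycle in steps of two, using these two edges as
  steps of one and making a single step of three, visits \<open>p + 1\<close> vertices that form a clique in
  \<open>A\<close> together with a clique in \<open>B\<close>; the step of three leaves room for one more vertex,
  an apex (\<open>two_colour_changes\<close>). So the two cliques have \<open>p + 2\<close> vertices together. If there are
  no two such edges, almost all of the cycle lies in one part, which then contains a \<open>p\<close>-clique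
  (\<open>two_part_cliques\<close>).

  A colouring without the required cliques would bound the cliques of colour \<open>i\<close> outside the
  dominating vertices by numbers \<open>d\<^sub>i < p\<close> with sum \<open>p + 1\<close>. Because \<open>p \<ge> 3\<close>, the colours
  can be merged into two groups whose \<open>d\<close>-sums lie between \<open>2\<close> and \<open>p - 1\<close> and add up to \<open>p + 1\<close>,
  which contradicts the dichotomy for \<open>A\<close> and \<open>B\<close> (\<open>folkman_arrows\<close>).
\<close>

section \<open>Cliques\<close>

lemma contains_clique_mono:
  assumes "contains_clique W E k" "l \<le> k"
  shows "contains_clique W E l"
proof -
  obtain K where K: "K \<subseteq> W" "finite K" "card K = k" "clique K E"
    using assms(1) by (auto simp: contains_clique_def)
  obtain L where L: "L \<subseteq> K" "card L = l"
    using obtain_subset_with_card_n[of l K] K assms(2) by auto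
  then have "clique L E"
    using K(4) by (auto simp: clique_def)
  then show ?thesis
    using K L finite_subset[of L K] by (auto simp: contains_clique_def)
qed

lemma clique_indexed:
  fixes g :: "'i::linorder \<Rightarrow> 'v"
  assumes "M \<subseteq> g ` I"
    and edge: "\<And>i j. i < j \<Longrightarrow> i \<in> I \<Longrightarrow> j \<in> I \<Longrightarrow> g i \<in> M \<Longrightarrow> g j \<in> M \<Longrightarrow> {g i, g j} \<in> E"
  shows "clique M E"
  unfolding clique_def
proof (intro ballI impI)
  fix u v assume uv: "u \<in> M" "v \<in> M" "u \<noteq> v"
  then obtain i j where ij: "i \<in> I" "j \<in> I" "u = g i" "v = g j"
    using assms(1) by blast
  consider "i < j" | "j < i" using uv ij by force
  then show "{u, v} \<in> E"
  proof cases
    case 1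
    then show ?thesis using edge uv ij by simp
  next
    case 2
    then have "{v, u} \<in> E" using edge uv ij by simp
    then show ?thesis by (simp add: insert_commute)
  qed
qed

lemma clique_number_le:
  assumes "\<And>K. K \<subseteq> V \<Longrightarrow> finite K \<Longrightarrow> clique K E \<Longrightarrow> card K \<le> q"
  shows "clique_number V E \<le> q"
proof -
  let ?S = "{k. contains_clique V E k}"
  have sub: "?S \<subseteq> {..q}"
    using assms by (auto simp: contains_clique_def)
  have "contains_clique V E 0"
    by (auto simp: contains_clique_def clique_def intro!: exI[of _ "{}"])
  then have "?S \<noteq> {}" by blast
  then show ?thesis
    unfolding clique_number_def using sub finite_subset[OF sub] by (subst Max_le_iff) auto
qed

section \<open>The graph\<close>

text \<open>
  Adjacency in the complement, oriented: the cycle is \<open>{..<n}\<close>, the apex \<open>y\<^sub>j\<close> is \<open>n + j\<close>, and every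
  vertex from \<open>2n\<close> on is isolated in the complement. The offsets \<open>0, 1, 4\<close> meet all \<open>p\<close>-element
  independent sets of the cycle, so an apex never extends a largest one.
\<close>

definition coadj :: "nat \<Rightarrow> nat \<Rightarrow> nat \<Rightarrow> bool" where
  "coadj n u v \<longleftrightarrow>
     u < n \<and> v = Suc u mod n \<or>
     u \<in> {n..<2*n} \<and> v \<in> {n..<2*n} \<or>
     u \<in> {n..<2*n} \<and> v \<in> {u - n, (u - n + 1) mod n, (u - n + 4) mod n}"

definition folkman_edges :: "nat \<Rightarrow> nat \<Rightarrow> nat set set" where
  "folkman_edges n t =
     {{u, v} | u v. u < 2*n + t \<and> v < 2*n + t \<and> u \<noteq> v \<and> \<not> coadj n u v \<and> \<not> coadj n v u}"

lemma in_folkman_edges: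
  "{u, v} \<in> folkman_edges n t \<longleftrightarrow>
     u < 2*n + t \<and> v < 2*n + t \<and> u \<noteq> v \<and> \<not> coadj n u v \<and> \<not> coadj n v u"
  unfolding folkman_edges_def by (auto simp: doubleton_eq_iff)

lemma simple_graph_folkman: "simple_graph {..<2*n + t} (folkman_edges n t)"
  unfolding simple_graph_def folkman_edges_def nsets_def by auto

lemma coadj_less:
  assumes "coadj n u v" "n > 0"
  shows "u < 2*n \<and> v < 2*n"
proof -
  have "x mod n < 2*n" for x using mod_less_divisor[OF assms(2), of x] by linarith
  then show ?thesis using assms(1) unfolding coadj_def by auto
qed

lemma dominating_edge:
  assumes "2*n \<le> u" "u < 2*n + t" "v < 2*n + t" "u \<noteq> v" "n > 0"
  shows "{u, v} \<in> folkman_edges n t"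
  using assms coadj_less[of n u v] coadj_less[of n v u] by (auto simp: in_folkman_edges)

lemma cycle_nonneighbours_edge:
  assumes "u < n" "v < n" "u \<noteq> v" "v \<noteq> Suc u mod n" "u \<noteq> Suc v mod n"
  shows "{u, v} \<in> folkman_edges n t"
  using assms by (auto simp: in_folkman_edges coadj_def)

lemma apex_nonneighbour_edge:
  assumes "j < n" "v < n" "v \<notin> {j, (j + 1) mod n, (j + 4) mod n}"
  shows "{n + j, v} \<in> folkman_edges n t"
proof -
  have "n + j \<noteq> Suc v mod n"
    using mod_less_divisor[of n "Suc v"] assms(1) by linarith
  then show ?thesis using assms by (auto simp: in_folkman_edges coadj_def)
qed

section \<open>The clique number\<close>

lemma card_mod_Suc_image:
  assumes "T \<subseteq> {..<n}"
  shows "card ((\<lambda>x. Suc x mod n) ` T) = card T"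
proof (rule card_image, rule inj_onI)
  fix x y assume "x \<in> T" "y \<in> T" "Suc x mod n = Suc y mod n"
  moreover have "x < n" "y < n" using assms \<open>x \<in> T\<close> \<open>y \<in> T\<close> by auto
  ultimately show "x = y" by (auto simp: mod_Suc split: if_splits)
qed

text \<open>
  An independent set of the cycle and its shift by one are disjoint sets of the same size. The set
  \<open>M\<close> collects vertices that both of them are known to miss.
\<close>

lemma cycle_independent_bound:
  assumes T: "T \<subseteq> {..<n}" and indep: "\<And>x. x \<in> T \<Longrightarrow> Suc x mod n \<notin> T"
    and M: "M \<subseteq> {..<n}" "M \<inter> T = {}" "\<And>x. x \<in> T \<Longrightarrow> Suc x mod n \<notin> M"
  shows "2 * card T + card M \<le> n"
proof -
  let ?S = "(\<lambda>x. Suc x mod n) ` T"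
  have fin: "finite T" "finite M" using T M(1) finite_subset by blast+
  have "?S \<subseteq> {..<n}" using T by (auto intro!: mod_less_divisor)
  then have "card (T \<union> ?S \<union> M) \<le> card {..<n}"
    using T M(1) by (intro card_mono) auto
  moreover have "card (T \<union> ?S \<union> M) = card T + card ?S + card M"
    using fin indep M by (subst card_Un_disjoint; (subst card_Un_disjoint)?) auto
  ultimately show ?thesis
    using card_mod_Suc_image[OF T] by simp
qed

text \<open>
  If the clique contains an apex \<open>y\<^sub>j\<close>, two vertices are missed by its cycle part \<open>T\<close> and by the
  shift of \<open>T\<close>, which makes \<open>T\<close> one smaller than in the bound for the whole cycle. One of them
  is \<open>x\<^sub>j\<^sub>+\<^sub>1\<close>, as \<open>x\<^sub>j\<close> is not in \<open>T\<close>.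
\<close>

lemma clique_card_le:
  assumes p: "p \<ge> 2" and n: "n = 2*p + 1"
    and K: "K \<subseteq> {..<2*n + t}" "clique K (folkman_edges n t)"
  shows "card K \<le> p + t"
proof -
  let ?T = "K \<inter> {..<n}" and ?Y = "K \<inter> {n..<2*n}" and ?Z = "K \<inter> {2*n..<2*n+t}"
  have fin: "finite K" using K(1) finite_subset by blast
  have no_coadj: "\<not> coadj n u v" if "u \<in> K" "v \<in> K" "u \<noteq> v" for u v
    using that K(2) unfolding clique_def by (auto simp: in_folkman_edges)
  have "K = ?T \<union> ?Y \<union> ?Z" using K(1) by auto
  then have "card K \<le> card ?T + card ?Y + card ?Z"
    by (metis (no_types, lifting) card_Un_le add_le_mono1 le_trans)
  moreover have "card ?Z \<le> t"
    using card_mono[of "{2*n..<2*n+t}" ?Z] by simp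
  moreover have "card ?T + card ?Y \<le> p"
  proof -
    have T: "?T \<subseteq> {..<n}" by auto
    have ind: "Suc x mod n \<notin> ?T" if "x \<in> ?T" for x
    proof
      assume "Suc x mod n \<in> ?T"
      moreover have "x \<noteq> Suc x mod n" using that n p by (auto simp: mod_Suc)
      ultimately show False using no_coadj[of x "Suc x mod n"] that by (auto simp: coadj_def)
    qed
    show ?thesis
    proof (cases "?Y = {}")
      case True
      then show ?thesis using cycle_independent_bound[OF T ind, of "{}"] n by simp
    next
      case False
      then obtain y where y: "y \<in> ?Y" by blast
      have "z = y" if "z \<in> ?Y" for z using y that no_coadj[of y z] by (auto simp: coadj_def)
      then have "?Y = {y}" using y by blast
      then have cY: "card ?Y = 1" by simp
      define e where "e i = (y - n + i) mod n" for i
      have eS: "Suc (e i) mod n = e (Suc i)" for i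
        by (simp add: e_def mod_Suc_eq)
      have e_inj: "e i \<noteq> e j" if "i < j" "j < 5" for i j
      proof
        assume "e i = e j"
        moreover have "i < n" "j < n" "y - n < n" using that p n y by auto
        ultimately show False using that(1) by (auto simp: e_def mod_if split: if_splits)
      qed
      have en: "e i < n" for i using n by (simp add: e_def)
      have e0: "e 0 = y - n" using y by (auto simp: e_def)
      have apart: "v \<notin> {e 0, e 1, e 4}" if "v \<in> ?T" for v
        unfolding e0 e_def[of 1] e_def[of 4]
        using no_coadj[of y v] that y by (auto simp: coadj_def)
      then have miss: "e 0 \<notin> ?T" "e 1 \<notin> ?T" "e 4 \<notin> ?T" by blast+
      have step: "x = e i" if "x \<in> ?T" "Suc x mod n = e (Suc i)" for x i
        using that en[of i] eS[of i] by (auto simp: mod_Suc split: if_splits)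
      \<comment> \<open>\<open>e 2\<close> is missed by the shift because \<open>e 1\<close> is not in \<open>T\<close>; if \<open>e 2\<close> itself is in \<open>T\<close>,
        then \<open>e 3\<close> is not, and \<open>e 4\<close> is missed instead.\<close>
      define s where "s = (if e 2 \<in> ?T then e 4 else e 2)"
      have s: "s \<notin> ?T" "s \<noteq> e 1" "s < n"
        using miss e_inj[of 1 4] e_inj[of 1 2] en by (auto simp: s_def)
      have "e 2 \<in> ?T \<Longrightarrow> e 3 \<notin> ?T"
        using ind[of "e 2"] eS[of 2] by (auto simp: numeral_eq_Suc)
      then have *: "Suc x mod n \<noteq> s" "Suc x mod n \<noteq> e 1" if "x \<in> ?T" for x
        using that step[of x 0] step[of x 1] step[of x 3] miss
        by (auto simp: s_def numeral_eq_Suc split: if_splits)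
      have "2 * card ?T + card {e 1, s} \<le> n"
        using s miss en * by (intro cycle_independent_bound[OF T ind]) auto
      then show ?thesis using s(2) cY n by auto
    qed
  qed
  ultimately show ?thesis by linarith
qed

section \<open>Splitting the graph into two parts\<close>

lemma offset_inj:
  fixes b i j n :: nat
  assumes "(b + i) mod n = (b + j) mod n" "i < n" "j < n"
  shows "i = j"
proof -
  have "x = y" if "x \<le> y" "y < n" "(b + x) mod n = (b + y) mod n" for x y
  proof -
    have "n dvd (b + y) - (b + x)"
      using that by (subst mod_eq_dvd_iff_nat[symmetric]) auto
    then show ?thesis using that(1,2) nat_dvd_not_less[of "y - x" n] by fastforce
  qed
  then show ?thesis using assms by (metis nat_le_linear)
qed

lemma cycle_edge:
  assumes n: "n \<ge> 3" and ij: "i < j" "j < n" "j \<noteq> Suc i" "\<not> (i = 0 \<and> Suc j = n)"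
  shows "{(b + i) mod n, (b + j) mod n} \<in> folkman_edges n t"
proof -
  have lt: "(b + k) mod n < n" for k using n by simp
  have "(b + i) mod n \<noteq> (b + j) mod n" using offset_inj[of b i n j] ij by auto
  moreover have "(b + j) mod n \<noteq> Suc (b + i) mod n"
    using offset_inj[of b j n "Suc i"] ij by auto
  moreover have "(b + i) mod n \<noteq> Suc (b + j) mod n"
  proof (cases "Suc j = n")
    case True
    then have "Suc (b + j) mod n = (b + 0) mod n" by (metis add_Suc_right mod_add_self2 add_0_right)
    then show ?thesis using offset_inj[of b i n 0] ij True by auto
  next
    case False
    then show ?thesis using offset_inj[of b i n "Suc j"] ij by auto
  qed
  ultimately show ?thesis
    using lt by (intro cycle_nonneighbours_edge) (simp_all add: mod_Suc_eq)
qed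

text \<open>
  The apex with index \<open>b - 3\<close> has its complement neighbours at the offsets \<open>n - 3\<close>, \<open>n - 2\<close> and \<open>1\<close>
  from \<open>b\<close>. It is written with \<open>b + (n - 3)\<close> to avoid subtraction below zero.
\<close>

lemma apex_edge:
  assumes n: "n \<ge> 5" and j: "j \<notin> {1, n - 2, n - 3}" "j < n"
  shows "{n + (b + (n - 3)) mod n, (b + j) mod n} \<in> folkman_edges n t"
proof -
  let ?y = "(b + (n - 3)) mod n"
  have lt: "(b + k) mod n < n" for k using n by simp
  have "(?y + 1) mod n = (b + (n - 2)) mod n"
    using n by (simp add: mod_Suc_eq Suc_diff_Suc numeral_eq_Suc)
  moreover have "(?y + 4) mod n = (b + 1) mod n"
  proof -
    have "(?y + 4) mod n = (b + (n - 3) + 4) mod n" by (simp add: mod_add_left_eq)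
    also have "b + (n - 3) + 4 = (b + 1) + n" using n by simp
    finally show ?thesis by (metis mod_add_self2)
  qed
  moreover have "(b + j) mod n \<noteq> ?y" "(b + j) mod n \<noteq> (b + (n - 2)) mod n"
      "(b + j) mod n \<noteq> (b + 1) mod n"
    using offset_inj[of b j n "n - 3"] offset_inj[of b j n "n - 2"] offset_inj[of b j n 1] j n
    by auto
  ultimately show ?thesis
    using lt by (intro apex_nonneighbour_edge) simp_all
qed

lemma alternating_clique:
  assumes p: "p \<ge> 1" and n: "n = 2*p + 1" and W: "\<And>i. i < p \<Longrightarrow> (b + 2*i) mod n \<in> W"
  shows "contains_clique W (folkman_edges n t) p"
proof -
  let ?g = "\<lambda>i. (b + 2*i) mod n"
  have "inj_on ?g {..<p}"
  proof (rule inj_onI)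
    fix i j assume "i \<in> {..<p}" "j \<in> {..<p}" "?g i = ?g j"
    then show "i = j" using offset_inj[of b "2*i" n "2*j"] n by auto
  qed
  then have "card (?g ` {..<p}) = p" by (simp add: card_image)
  moreover have "clique (?g ` {..<p}) (folkman_edges n t)"
    by (rule clique_indexed[OF order_refl]) (use n in \<open>auto intro!: cycle_edge\<close>, presburger)
  ultimately show ?thesis
    unfolding contains_clique_def using W by (intro exI[of _ "?g ` {..<p}"]) auto
qed

text \<open>
  The edges \<open>(b - 1, b)\<close> and \<open>(b + 2k, b + 2k + 1)\<close> of the cycle run between the parts. The vertices at
  the offsets \<open>0, 2, \<dots>, 2k\<close>, then \<open>2k + 1, 2k + 3, \<dots>, 2p - 3\<close>, then \<open>2p\<close> contain no other pair of
  neighbours on the cycle, so those in either part form a clique. They avoid the offsets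
  \<open>1\<close>, \<open>2p - 2\<close> and \<open>2p - 1\<close>, so the apex with index \<open>b - 3\<close> extends the clique of the part that
  it belongs to.
\<close>

lemma two_colour_changes:
  assumes n: "n = 2*p + 1" and k: "1 \<le> k" "k + 2 \<le> p"
    and cover: "{..<2*n} \<subseteq> A \<union> B"
    and change: "b mod n \<in> A \<longleftrightarrow> (b + 2*p) mod n \<notin> A"
      "(b + 2*k) mod n \<in> A \<longleftrightarrow> (b + Suc (2*k)) mod n \<notin> A"
  shows "\<exists>k l. contains_clique A (folkman_edges n t) k \<and>
    contains_clique B (folkman_edges n t) l \<and> k + l = p + 2"
proof -
  define f where "f i = (if i \<le> k then 2*i else if i < p then 2*i - 1 else 2*p)" for i
  define g where "g i = (b + f i) mod n" for i
  define y where "y = n + (b + (n - 3)) mod n"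
  define K where "K = g ` {..p} \<inter> A"
  define L where "L = g ` {..p} - A"
  let ?E = "folkman_edges n t"
  have f_mono: "f i < f j" if "i < j" "j \<le> p" for i j
    using that k by (auto simp: f_def)
  have f_less: "f i < n" if "i \<le> p" for i using that n by (auto simp: f_def)
  have inj: "inj_on g {..p}"
  proof (rule inj_onI)
    fix i j assume ij: "i \<in> {..p}" "j \<in> {..p}" "g i = g j"
    then have "f i = f j" using offset_inj[of b "f i" n "f j"] f_less by (auto simp: g_def)
    then show "i = j" using f_mono[of i j] f_mono[of j i] ij by (cases i j rule: linorder_cases) auto
  qed
  have edge: "{g i, g j} \<in> ?E" if ij: "i < j" "j \<le> p" and same: "g i \<in> A \<longleftrightarrow> g j \<in> A" for i j
    unfolding g_def
  proof (rule cycle_edge)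
    show "f j \<noteq> Suc (f i)"
    proof
      assume *: "f j = Suc (f i)"
      then have "i = k \<and> j = Suc k"
        using ij k by (auto simp: f_def split: if_splits)
      then show False using same change(2) k by (auto simp: g_def f_def)
    qed
    show "\<not> (f i = 0 \<and> Suc (f j) = n)"
    proof
      assume "f i = 0 \<and> Suc (f j) = n"
      then have "i = 0 \<and> j = p" using ij n k by (auto simp: f_def split: if_splits)
      then show False using same change(1) k by (auto simp: g_def f_def)
    qed
  qed (use ij n k f_mono f_less in auto)
  have cl: "clique M ?E"
    if M: "M \<subseteq> g ` {..p}" and same: "\<And>u v. u \<in> M \<Longrightarrow> v \<in> M \<Longrightarrow> u \<in> A \<longleftrightarrow> v \<in> A" for M
    using M by (rule clique_indexed) (rule edge; use same in blast)
  have clK: "clique K ?E" and clL: "clique L ?E"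
    by (rule cl; force simp: K_def L_def)+
  have y_edge: "{y, g i} \<in> ?E" if "i \<le> p" for i
    unfolding y_def g_def
    by (rule apex_edge) (use that k n in \<open>auto simp: f_def split: if_splits\<close>)
  have cl_y: "clique (insert y M) ?E" if "clique M ?E" "M \<subseteq> g ` {..p}" for M
    using that y_edge by (fastforce simp: clique_def insert_commute)
  have g_less: "g i < n" for i using n by (simp add: g_def)
  have fin: "finite K" "finite L" by (auto simp: K_def L_def)
  have "card K + card L = card (K \<union> L)"
    using fin by (subst card_Un_disjoint) (auto simp: K_def L_def)
  also have "K \<union> L = g ` {..p}" by (auto simp: K_def L_def)
  finally have card: "card K + card L = p + 1" using inj by (simp add: card_image)
  have K: "K \<subseteq> A" by (auto simp: K_def)
  have "g ` {..p} \<subseteq> {..<2*n}" using g_less by (auto simp: mult_2 trans_less_add1)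
  then have L: "L \<subseteq> B" using cover by (auto simp: L_def)
  have yn: "n \<le> y" "y < 2*n" using n by (auto simp: y_def)
  then have ynot: "y \<notin> K" "y \<notin> L"
    using g_less by (auto simp: K_def L_def) (metis not_less)+
  have cA: "contains_clique A ?E (card K)" and cB: "contains_clique B ?E (card L)"
    using K L clK clL fin by (auto simp: contains_clique_def)
  have "y \<in> A \<or> y \<in> B" using cover yn by auto
  then show ?thesis
  proof
    assume "y \<in> A"
    then have "contains_clique A ?E (card K + 1)"
      unfolding contains_clique_def
      using cl_y[OF clK] K fin ynot by (intro exI[of _ "insert y K"]) (auto simp: K_def)
    then show ?thesis using cB card by (intro exI[of _ "card K + 1"] exI[of _ "card L"]) auto
  next
    assume "y \<in> B"
    then have "contains_clique B ?E (card L + 1)"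
      unfolding contains_clique_def
      using cl_y[OF clL] L fin ynot by (intro exI[of _ "insert y L"]) (auto simp: L_def)
    then show ?thesis using cA card by (intro exI[of _ "card K"] exI[of _ "card L + 1"]) auto
  qed
qed

text \<open>
  Fix one edge \<open>(b - 1, b)\<close> between the parts and look for a second one at distance at least three.
  The two edges cut the odd cycle into arcs of different parity, so by exchanging their roles the
  second one is at an even offset from the first. If there is no second one, the offsets
  \<open>2, \<dots>, 2p - 2\<close> lie in one part, and so does one of the offsets \<open>0\<close> and \<open>2p\<close>, since these two lie in
  different parts.
\<close>

lemma two_part_cliques:
  assumes p: "p \<ge> 3" and n: "n = 2*p + 1" and cover: "{..<2*n} \<subseteq> A \<union> B"
  shows "contains_clique A (folkman_edges n t) p \<or> contains_clique B (folkman_edges n t) p \<or>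
    (\<exists>k l. contains_clique A (folkman_edges n t) k \<and>
      contains_clique B (folkman_edges n t) l \<and> k + l = p + 2)"
proof -
  define c where "c i \<longleftrightarrow> i mod n \<in> A" for i
  have cn: "c (i + n) = c i" for i by (simp add: c_def)
  have mono: ?thesis if "\<And>i. i < p \<Longrightarrow> c (b + 2*i) = col" for b col
  proof -
    have "(b + 2*i) mod n \<in> (if col then A else B)" if "i < p" for i
    proof -
      have "(b + 2*i) mod n < 2*n" using n mod_less_divisor[of n "b + 2*i"] by linarith
      then show ?thesis using \<open>\<And>i. i < p \<Longrightarrow> c (b + 2*i) = col\<close>[OF that] cover
        by (auto simp: c_def)
    qed
    then have "contains_clique (if col then A else B) (folkman_edges n t) p"
      using p n by (intro alternating_clique) auto
    then show ?thesis by (auto split: if_splits)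
  qed
  have changes: ?thesis
    if "c b \<noteq> c (b + 2*p)" "c (b + 2*k) \<noteq> c (b + Suc (2*k))" "1 \<le> k" "k + 2 \<le> p" for b k
    using two_colour_changes[OF n _ _ cover, of k b t] that unfolding c_def by blast
  show ?thesis
  proof (cases "\<exists>b. c b \<noteq> c (b + 2*p)")
    case False
    \<comment> \<open>A step of \<open>2p\<close> is a step of \<open>-1\<close> around the cycle.\<close>
    have "c (Suc i) = c i" for i
      using False cn[of i] n by (metis add_Suc add_Suc_right Suc_eq_plus1)
    then have "c i = c 0" for i by (induction i) auto
    then show ?thesis by (intro mono[of 0 "c 0"]) auto
  next
    case True
    then obtain b where b: "c b \<noteq> c (b + 2*p)" by blast
    show ?thesis
    proof (cases "\<exists>i. 2 \<le> i \<and> i + 3 \<le> 2*p \<and> c (b + i) \<noteq> c (b + Suc i)")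
      case True
      then obtain i where i: "2 \<le> i" "i + 3 \<le> 2*p" "c (b + i) \<noteq> c (b + Suc i)" by blast
      show ?thesis
      proof (cases "even i")
        case True
        then obtain k where "i = 2*k" by blast
        then show ?thesis using changes[OF b, of k] i by auto
      next
        case False
        then obtain l where l: "i = Suc (2*l)" by (auto elim: oddE)
        define k where "k = p - Suc l"
        have k: "1 \<le> k" "k + 2 \<le> p" "p = Suc l + k" using l i by (auto simp: k_def)
        have "b + Suc i + 2*p = (b + i) + n" "b + Suc i + 2*k = b + 2*p"
          "b + Suc i + Suc (2*k) = b + n"
          using l k(3) n by auto
        then show ?thesis
          using changes[of "b + Suc i" k] k(1,2) i(3) b cn by metis
      qed
    next
      case False
      have const: "c (b + 2 + i) = c (b + 2)" if "i + 4 \<le> 2*p" for i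
        using that
      proof (induction i)
        case (Suc i)
        have "c (b + (i + 2)) = c (b + Suc (i + 2))"
          using False[simplified, rule_format, of "i + 2"] Suc.prems by auto
        then show ?case using Suc by (auto simp: add_ac)
      qed auto
      show ?thesis
      proof (cases "c b = c (b + 2)")
        case True
        have "c (b + 2*i) = c (b + 2)" if "i < p" for i
          using that const[of "2*(i - 1)"] True by (cases i) auto
        then show ?thesis by (rule mono)
      next
        case F: False
        have "c (b + 2 + 2*i) = c (b + 2)" if "i < p" for i
        proof (cases "Suc i = p")
          case True
          then have "b + 2 + 2*i = b + 2*p" by auto
          then show ?thesis using b F by (metis (full_types))
        next
          case False
          then show ?thesis using that const[of "2*i"] by auto
        qed
        then show ?thesis by (rule mono)
      qed
    qed
  qed
qed

section \<open>Several colours and dominating vertices\<close>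

lemma card_clique_UN_le:
  assumes J: "finite J" and K: "K \<subseteq> (\<Union>i\<in>J. Q i)" "finite K" "clique K E"
    and bound: "\<And>i. i \<in> J \<Longrightarrow> \<not> contains_clique (Q i) E (Suc (d i))"
  shows "card K \<le> sum d J"
proof -
  have "card (K \<inter> Q i) \<le> d i" if "i \<in> J" for i
  proof -
    have "contains_clique (Q i) E (card (K \<inter> Q i))"
      unfolding contains_clique_def
      using K by (intro exI[of _ "K \<inter> Q i"]) (auto simp: clique_def)
    then show ?thesis using bound[OF that] contains_clique_mono not_less_eq_eq by blast
  qed
  moreover have "K = (\<Union>i\<in>J. K \<inter> Q i)" using K(1) by blast
  then have "card K \<le> (\<Sum>i\<in>J. card (K \<inter> Q i))"
    by (metis card_UN_le[OF J])
  ultimately show ?thesis by (meson order_trans sum_mono)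
qed

text \<open>
  One value of at least two is enough by itself; otherwise all values are at most one, and two
  ones sum to \<open>2 < p\<close>.
\<close>

lemma subset_sum_between:
  fixes d :: "'a \<Rightarrow> nat"
  assumes I: "finite I" and p: "p \<ge> 3" and d: "\<And>i. i \<in> I \<Longrightarrow> d i < p" "sum d I \<ge> 2"
  shows "\<exists>J \<subseteq> I. 2 \<le> sum d J \<and> sum d J < p"
proof (cases "\<exists>i\<in>I. d i \<ge> 2")
  case True
  then obtain i where "i \<in> I" "d i \<ge> 2" by blast
  then show ?thesis using d(1) by (intro exI[of _ "{i}"]) auto
next
  case False
  let ?S = "{i \<in> I. d i = 1}"
  have "sum d I = sum d ?S"
    by (rule sum.mono_neutral_right) (use I False in \<open>force+\<close>)
  also have "\<dots> = card ?S" by simp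
  finally have "2 \<le> card ?S" using d(2) by simp
  then obtain J where "J \<subseteq> ?S" "card J = 2" by (meson obtain_subset_with_card_n)
  moreover from this have "sum d J = (\<Sum>i\<in>J. 1)" by (intro sum.cong) auto
  ultimately show ?thesis using p by (intro exI[of _ J]) auto
qed

text \<open>
  The dominating vertices of colour \<open>i\<close> join every clique of that colour, so they lower the size that
  is allowed for the remaining cliques from \<open>a i - 1\<close> to \<open>d i\<close>. The \<open>d i\<close> bound cliques of unions
  of colour classes additively, which permits merging colours.
\<close>

lemma folkman_arrows:
  assumes p: "p \<ge> 3" and n: "n = 2*p + 1"
    and a: "\<And>i. i \<in> {1..r} \<Longrightarrow> 1 \<le> a i \<and> a i \<le> p"
    and sum: "(\<Sum>i=1..r. a i - 1) = p + 1 + t"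
  shows "arrows {..<2*n + t} (folkman_edges n t) r a"
  unfolding arrows_def
proof (intro allI impI, rule ccontr)
  let ?E = "folkman_edges n t"
  fix P :: "nat \<Rightarrow> nat set"
  assume P: "disjoint_family_on P {1..r} \<and> (\<Union>i\<in>{1..r}. P i) = {..<2*n + t}"
    and "\<not> (\<exists>i\<in>{1..r}. contains_clique (P i) ?E (a i))"
  then have no: "\<not> contains_clique (P i) ?E (a i)" if "i \<in> {1..r}" for i
    using that by blast
  define Q where "Q i = P i \<inter> {..<2*n}" for i
  define Z where "Z i = P i \<inter> {2*n..<2*n + t}" for i
  define d where "d i = a i - 1 - card (Z i)" for i
  have finZ: "finite (Z i)" for i by (simp add: Z_def)
  have join: "contains_clique (P i) ?E (k + card (Z i))"
    if i: "i \<in> {1..r}" and k: "contains_clique (Q i) ?E k" for i k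
  proof -
    obtain K where K: "K \<subseteq> Q i" "finite K" "card K = k" "clique K ?E"
      using k by (auto simp: contains_clique_def)
    have Kl: "K \<subseteq> {..<2*n}" using K(1) by (auto simp: Q_def)
    have "clique (K \<union> Z i) ?E"
    proof (rule clique_Un[OF K(4)])
      show "clique (Z i) ?E"
        unfolding clique_def Z_def using n by (auto intro!: dominating_edge)
      show "\<forall>v\<in>K. \<forall>w\<in>Z i. v \<noteq> w \<longrightarrow> {v, w} \<in> ?E"
      proof (intro ballI impI)
        fix v w assume "v \<in> K" "w \<in> Z i" "v \<noteq> w"
        then have "{w, v} \<in> ?E" using Kl n by (intro dominating_edge) (auto simp: Z_def)
        then show "{v, w} \<in> ?E" by (simp add: insert_commute)
      qed
    qed
    moreover have "K \<inter> Z i = {}" using Kl by (force simp: Z_def)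
    then have "card (K \<union> Z i) = k + card (Z i)"
      using K(2,3) finZ by (simp add: card_Un_disjoint)
    ultimately show ?thesis
      unfolding contains_clique_def using K(1,2) finZ
      by (intro exI[of _ "K \<union> Z i"]) (auto simp: Q_def Z_def)
  qed
  have Z_less: "card (Z i) < a i" if i: "i \<in> {1..r}" for i
  proof -
    have "contains_clique (Q i) ?E 0" by (auto simp: contains_clique_def intro!: exI[of _ "{}"])
    from join[OF i this] show ?thesis
      using no[OF i] contains_clique_mono[of "P i" ?E "card (Z i)" "a i"] by fastforce
  qed
  have bound: "\<not> contains_clique (Q i) ?E (Suc (d i))" if i: "i \<in> {1..r}" for i
    using join[OF i, of "Suc (d i)"] no[OF i] Z_less[OF i] by (auto simp: d_def)
  have "(\<Sum>i=1..r. card (Z i)) = card (\<Union>i\<in>{1..r}. Z i)"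
    using P finZ by (subst card_UN_disjoint) (auto simp: Z_def disjoint_family_on_def)
  also have "(\<Union>i\<in>{1..r}. Z i) = {2*n..<2*n + t}"
  proof -
    have "(\<Union>i\<in>{1..r}. Z i) = (\<Union>i\<in>{1..r}. P i) \<inter> {2*n..<2*n + t}" by (auto simp: Z_def)
    then show ?thesis using P by auto
  qed
  finally have "(\<Sum>i=1..r. card (Z i)) = t" by simp
  moreover have "(\<Sum>i=1..r. d i) + (\<Sum>i=1..r. card (Z i)) = (\<Sum>i=1..r. a i - 1)"
    unfolding sum.distrib[symmetric] using Z_less by (intro sum.cong) (force simp: d_def)+
  ultimately have sumd: "sum d {1..r} = p + 1" using sum by simp
  have dp: "d i < p" if "i \<in> {1..r}" for i using a[OF that] by (auto simp: d_def)
  obtain J where J: "J \<subseteq> {1..r}" "2 \<le> sum d J" "sum d J < p"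
    using subset_sum_between[of "{1..r}" p d] p dp sumd by auto
  define A where "A = (\<Union>i\<in>J. Q i)"
  define B where "B = (\<Union>i\<in>{1..r} - J. Q i)"
  have finJ: "finite J" using J(1) finite_subset by blast
  have A: "k \<le> sum d J" if "contains_clique A ?E k" for k
    using that card_clique_UN_le[OF finJ, of _ Q ?E d] bound J(1)
    unfolding contains_clique_def A_def by blast
  have B: "k \<le> sum d ({1..r} - J)" if "contains_clique B ?E k" for k
    using that card_clique_UN_le[of "{1..r} - J" _ Q ?E d] bound
    unfolding contains_clique_def B_def by blast
  have split: "sum d J + sum d ({1..r} - J) = p + 1"
    using sum.subset_diff[OF J(1), of d] sumd by simp
  have "{..<2*n} \<subseteq> A \<union> B"
  proof
    fix v assume v: "v \<in> {..<2*n}"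
    then have "v \<in> (\<Union>i\<in>{1..r}. P i)" using P by auto
    then show "v \<in> A \<union> B" using v by (auto simp: A_def B_def Q_def)
  qed
  from two_part_cliques[OF p n this, of t] show False
    using A B J(2,3) split by fastforce
qed

theorem mainTheorem1:
  fixes r m p :: nat and a :: "nat \<Rightarrow> nat"
  assumes "r \<ge> 1"
    and "\<And>i. i \<in> {1..r} \<Longrightarrow> a i \<ge> 1"
    and "m = (\<Sum>i=1..r. (a i - 1)) + 1"
    and "p = Max (a ` {1..r})"
    and "m \<ge> p + 2"
    and "p \<ge> 3"
  shows "vertex_Folkman r a (m - 1) \<le> enat (m + 3 * p)"
proof -
  define n t where n_t_def: "n = 2*p + 1" "t = m - (p + 2)"
  let ?V = "{..<2*n + t}" and ?E = "folkman_edges n t"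
  have "a i \<le> p" if "i \<in> {1..r}" for i
    unfolding assms(4) using that by (intro Max_ge) auto
  moreover have "(\<Sum>i=1..r. a i - 1) = p + 1 + t"
    using assms(3,5) by (simp add: n_t_def)
  ultimately have "arrows ?V ?E r a"
    using assms(2) by (intro folkman_arrows[OF assms(6) n_t_def(1)]) auto
  moreover have "clique_number ?V ?E \<le> p + t"
    using assms(6) by (intro clique_number_le clique_card_le) (auto simp: n_t_def)
  then have "clique_number ?V ?E < m - 1" using assms(5) by (simp add: n_t_def)
  ultimately have "vertex_Folkman r a (m - 1) \<le> enat (card ?V)"
    unfolding vertex_Folkman_def using simple_graph_folkman[of n t] by (intro Inf_lower) blast
  also have "card ?V = m + 3 * p" using assms(5) by (simp add: n_t_def)
  finally show ?thesis .
qed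

end
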